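(* Let $0<p<1$ and $q=1-p$. For $n\ge1$ and $j\ge0$ let $\mathrm{pr}(0,j,n)$ be the probability that, at a circular table for $n$ people, every guest gets a napkin and exactly $j$ guests are frustrated, and let $C(0,y,z)=\sum_{n\ge1}\sum_{j\ge0}\mathrm{pr}(0,j,n)\,y^jz^n$. Then $$C(0,y,z)=z\left(1+\frac{(p+qy)\,p\,(e^{qyz}-1)}{qy-p(e^{qyz}-1)}+\frac{(py+q)\,q\,(e^{pyz}-1)}{py-q(e^{pyz}-1)}\right),$$ where the right-hand side is expanded as a power series in $z$.
   Context: Circular table model. There are $n$ places labelled $1,\dots,n$ counter-clockwise around a circular table; place $i-1$ is to the left of place $i$ and place $i+1$ is to its right (indices cyclic). There are $n$ napkins, exactly one between each pair of cyclically consecutive places, so each place has a left napkin and a right napkin (for $n=1$ these are the same single napkin). The guests sit down one at a time in uniformly random order. Independently, each guest prefers the left napkin with probability $p$ and the right napkin with probability $q=1-p$. On sitting down, a guest takes his preferred napkin if it is available; otherwise he takes the other adjacent napkin if that one is available; otherwise he gets no napkin. A guest is frustrated if he gets a napkin but not the one he prefers. *)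

theory Defs
  imports
    "HOL-Probability.Probability"
    "HOL-Computational_Algebra.Formal_Laurent_Series"
begin

text \<open>
  Places are numbered \<open>0, \<dots>, n - 1\<close> counter-clockwise, with indices taken modulo \<open>n\<close>.
  Napkin \<open>i\<close> lies between places \<open>i - 1\<close> and \<open>i\<close>, so it is the left napkin of place \<open>i\<close>,
  whose right napkin is \<open>i + 1\<close>. For \<open>n = 1\<close> the two coincide.
  A guest is identified with the place he sits at; a preference function maps
  a place to \<open>True\<close> iff its guest prefers the left napkin.
\<close>

definition left_napkin :: "nat \<Rightarrow> nat \<Rightarrow> nat" where
  "left_napkin n i = i"

definition right_napkin :: "nat \<Rightarrow> nat \<Rightarrow> nat" where
  "right_napkin n i = (i + 1) mod n"

definition preferred_napkin :: "nat \<Rightarrow> (nat \<Rightarrow> bool) \<Rightarrow> nat \<Rightarrow> nat" where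
  "preferred_napkin n pref i = (if pref i then left_napkin n i else right_napkin n i)"

definition other_napkin :: "nat \<Rightarrow> (nat \<Rightarrow> bool) \<Rightarrow> nat \<Rightarrow> nat" where
  "other_napkin n pref i = (if pref i then right_napkin n i else left_napkin n i)"

text \<open>\<open>A\<close> is the set of napkins still on the table.\<close>

definition take_napkin :: "nat \<Rightarrow> (nat \<Rightarrow> bool) \<Rightarrow> nat set \<Rightarrow> nat \<Rightarrow> nat option" where
  "take_napkin n pref A i =
     (if preferred_napkin n pref i \<in> A then Some (preferred_napkin n pref i)
      else if other_napkin n pref i \<in> A then Some (other_napkin n pref i)
      else None)"

text \<open>The list gives the places in the order in which they become occupied.\<close>

fun seat_guests :: "nat \<Rightarrow> (nat \<Rightarrow> bool) \<Rightarrow> nat list \<Rightarrow> nat set \<Rightarrow> (nat \<Rightarrow> nat option)" where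
  "seat_guests n pref [] A = (\<lambda>_. None)"
| "seat_guests n pref (i # is) A =
     (seat_guests n pref is (A - set_option (take_napkin n pref A i)))
       (i := take_napkin n pref A i)"

definition napkin_of :: "nat \<Rightarrow> nat list \<Rightarrow> (nat \<Rightarrow> bool) \<Rightarrow> nat \<Rightarrow> nat option" where
  "napkin_of n ord pref = seat_guests n pref ord {..<n}"

definition frustrated :: "nat \<Rightarrow> nat list \<Rightarrow> (nat \<Rightarrow> bool) \<Rightarrow> nat \<Rightarrow> bool" where
  "frustrated n ord pref i \<longleftrightarrow>
     (\<exists>k. napkin_of n ord pref i = Some k \<and> k \<noteq> preferred_napkin n pref i)"

definition table_pmf :: "real \<Rightarrow> nat \<Rightarrow> (nat list \<times> (nat \<Rightarrow> bool)) pmf" where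
  "table_pmf p n =
     pair_pmf (pmf_of_set (permutations_of_set {..<n}))
              (Pi_pmf {..<n} False (\<lambda>_. bernoulli_pmf p))"

definition pr0 :: "real \<Rightarrow> nat \<Rightarrow> nat \<Rightarrow> real" where
  "pr0 p j n = measure_pmf.prob (table_pmf p n)
     {(ord, pref). (\<forall>i<n. napkin_of n ord pref i \<noteq> None) \<and>
                   card {i. i < n \<and> frustrated n ord pref i} = j}"

text \<open>
  Generating functions are power series in \<open>z\<close> over the field of formal Laurent series
  in \<open>y\<close>. Over this field a power series in \<open>z\<close> with constant term \<open>q y\<close> is invertible,
  which it is not over power series in \<open>y\<close>.
\<close>

definition gf_y :: "real fls" where
  "gf_y = fls_X"

definition gf_C0 :: "real \<Rightarrow> real fls fps" where
  "gf_C0 p = Abs_fps (\<lambda>n. if n = 0 then 0 else fps_to_fls (Abs_fps (\<lambda>j. pr0 p j n)))"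

end

theory Submission
  imports Defs
begin

text \<open>
  Suppose that \<open>n \<ge> 2\<close> and that every guest gets a napkin. Then every napkin is used, and a
  guest who takes his right napkin forces his right neighbour to do the same; so all guests take
  the napkin on the same side. All take the left one iff every guest who prefers the right
  finds it gone, that is, iff his right neighbour sat down before him, and exactly these guests
  are then frustrated. Conditionally on the seating order, written as the list of
  seating times around the table, guests at a cyclic ascent must therefore prefer the left
  (weight \<open>p\<close>), and guests at a cyclic descent are free (weight \<open>p + q y\<close>). This is
  \<open>all_side_iff_times\<close>, and its probabilistic form is \<open>pr0_eq\<close>.

  Summing \<open>p\<close> to the number of cyclic ascents times \<open>p + q y\<close> to the number of cyclic
  descents over all lists, one may rotate the largest time to the front. It contributes one
  ascent and one descent and leaves a linear arrangement of the other \<open>n - 1\<close> times; hence the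
  sum is \<open>n p (p + q y) A (n - 1)\<close>, where \<open>A m\<close> is the homogeneous Eulerian polynomial in the
  two weights (\<open>sum_cycle_weight\<close>). Division by \<open>n!\<close> leaves \<open>p (p + q y) A (n - 1) / (n - 1)!\<close>,
  which is why an exponential generating function appears, shifted by one factor \<open>z\<close>.

  With weights \<open>a\<close> and \<open>b\<close> of an ascent and a descent, cutting a permutation at its maximum
  gives \<open>F' = (1 + a F) (1 + b F)\<close> for the exponential generating function \<open>F\<close> of \<open>A\<close>. The quotient of the two factors
  solves a linear equation and equals \<open>exp ((b - a) z)\<close>, and solving for \<open>F\<close> gives the closed
  form (\<open>eulerian_egf_eq\<close>). For \<open>a = p\<close> and \<open>b = p + q y\<close> it is the first fraction of
  the theorem. The case that all take the right napkin is the mirror image, with \<open>p\<close> and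
  \<open>q\<close> exchanged. A table for one has a single napkin, never frustrates, and accounts for the
  summand \<open>1\<close>.
\<close>

section \<open>Permutations weighted by ascents and descents\<close>

definition step_weight :: "'a \<Rightarrow> 'a \<Rightarrow> nat \<Rightarrow> nat \<Rightarrow> 'a" where
  "step_weight a b x y = (if x < y then a else b)"

fun path_weight :: "'a :: comm_ring_1 \<Rightarrow> 'a \<Rightarrow> nat list \<Rightarrow> 'a" where
  "path_weight a b (x # y # xs) = step_weight a b x y * path_weight a b (y # xs)"
| "path_weight a b xs = 1"

definition cycle_weight :: "'a :: comm_ring_1 \<Rightarrow> 'a \<Rightarrow> nat list \<Rightarrow> 'a" where
  "cycle_weight a b xs =
     (\<Prod>i<length xs. step_weight a b (xs ! i) (xs ! (Suc i mod length xs)))"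

text \<open>
  The Eulerian polynomial of degree \<open>m - 1\<close>, made homogeneous in the weights of ascents and
  descents (and \<open>1\<close> for \<open>m = 0\<close>).
\<close>

definition eulerian :: "'a :: comm_ring_1 \<Rightarrow> 'a \<Rightarrow> nat \<Rightarrow> 'a" where
  "eulerian a b m = (\<Sum>xs\<in>permutations_of_set {..<m}. path_weight a b xs)"

lemma path_weight_append:
  "path_weight a b (us @ x # vs) = path_weight a b (us @ [x]) * path_weight a b (x # vs)"
  by (induction a b us rule: path_weight.induct) (cases vs; simp add: mult.assoc)+

lemma path_weight_max_Cons:
  assumes "\<forall>x\<in>set vs. x < m"
  shows "path_weight a b (m # vs) = (if vs = [] then 1 else b * path_weight a b vs)"
  using assms by (cases vs) (auto simp: step_weight_def)

lemma path_weight_max_snoc: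
  assumes "\<forall>x\<in>set us. x < m"
  shows "path_weight a b (us @ [m]) = (if us = [] then 1 else a * path_weight a b us)"
  using assms
  by (induction a b us rule: path_weight.induct) (auto simp: step_weight_def mult_ac)

lemma path_weight_map:
  assumes "strict_mono_on A h" "set xs \<subseteq> A"
  shows "path_weight a b (map h xs) = path_weight a b xs"
  using assms(2)
proof (induction a b xs rule: path_weight.induct)
  case (1 a b x y xs)
  have "h x < h y \<longleftrightarrow> x < y"
    using 1(2) strict_mono_on_less[OF assms(1), of x y] by auto
  then show ?case using 1 by (simp add: step_weight_def)
qed simp_all

text \<open>
  Ascents and descents only depend on the relative order, so the increasing enumeration of \<open>A\<close>
  preserves the weight. This spares the renumbering of the two parts of a permutation that is
  cut at its maximum.
\<close>

lemma sum_path_weight_eq_eulerian: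
  assumes "finite A"
  shows "(\<Sum>xs\<in>permutations_of_set A. path_weight a b xs) = eulerian a b (card A)"
proof -
  obtain h where h: "bij_betw h {..<card A} A" "strict_mono_on {..<card A} h"
    using ex_bij_betw_strict_mono_card[OF assms] .
  have A: "A = h ` {..<card A}" and inj: "inj_on h {..<card A}"
    using h(1) by (auto simp: bij_betw_def)
  have inj': "inj_on (map h) (permutations_of_set {..<card A})"
    by (rule inj_on_mapI, rule inj_on_subset[OF inj]) (auto simp: permutations_of_set_def)
  have "permutations_of_set A = map h ` permutations_of_set {..<card A}"
    using permutations_of_set_image_inj[OF inj] unfolding A[symmetric] .
  then have "(\<Sum>xs\<in>permutations_of_set A. path_weight a b xs)
      = (\<Sum>xs\<in>permutations_of_set {..<card A}. path_weight a b (map h xs))"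
    by (simp only: sum.reindex[OF inj'] o_def)
  also have "\<dots> = eulerian a b (card A)"
    unfolding eulerian_def
    by (rule sum.cong) (auto dest: permutations_of_setD intro!: path_weight_map[OF h(2)])
  finally show ?thesis .
qed

lemma sum_permutations_split_at:
  fixes g :: "'b list \<Rightarrow> 'a :: comm_monoid_add"
  assumes "finite A" "m \<notin> A"
  shows "(\<Sum>xs\<in>permutations_of_set (insert m A). g xs) =
    (\<Sum>B\<in>Pow A. \<Sum>ys\<in>permutations_of_set B. \<Sum>zs\<in>permutations_of_set (A - B). g (ys @ m # zs))"
proof -
  let ?S = "SIGMA B:Pow A. permutations_of_set B \<times> permutations_of_set (A - B)"
  let ?f = "\<lambda>(B, ys, zs). ys @ m # zs"
  have inj: "inj_on ?f ?S"
  proof (rule inj_onI)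
    fix s t assume st: "s \<in> ?S" "t \<in> ?S" "?f s = ?f t"
    obtain B ys zs C us vs where s: "s = (B, ys, zs)" and t: "t = (C, us, vs)"
      by (cases s, cases t) auto
    have sets: "B \<subseteq> A" "set ys = B" "set zs = A - B" "set us = C"
      using st(1,2) unfolding s t by (simp_all add: permutations_of_set_def)
    then have m: "m \<notin> set ys" "m \<notin> set zs" using assms(2) by auto
    have "ys @ m # zs = us @ m # vs" using st(3) unfolding s t by simp
    then have "ys = us \<and> zs = vs" using append_Cons_eq_iff[OF m] by simp
    then show "s = t" using sets unfolding s t by simp
  qed
  have "?f ` ?S = permutations_of_set (insert m A)"
  proof (intro equalityI subsetI)
    fix xs assume "xs \<in> permutations_of_set (insert m A)"
    then have xs: "set xs = insert m A" "distinct xs" by (auto dest: permutations_of_setD)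
    then obtain ys zs where yz: "xs = ys @ m # zs" by (metis insertI1 split_list)
    have "set ys \<subseteq> A" "set zs = A - set ys" "distinct ys" "distinct zs"
      using xs yz assms by auto
    then have "(set ys, ys, zs) \<in> ?S" by (simp add: permutations_of_set_def)
    then show "xs \<in> ?f ` ?S" by (rule rev_image_eqI) (simp add: yz)
  qed (use assms in \<open>auto simp: permutations_of_set_def\<close>)
  then have "(\<Sum>xs\<in>permutations_of_set (insert m A). g xs) = (\<Sum>t\<in>?S. g (?f t))"
    using sum.reindex[OF inj, of g] by simp
  also have "\<dots> = (\<Sum>B\<in>Pow A. \<Sum>(ys, zs)\<in>permutations_of_set B \<times> permutations_of_set (A - B). g (ys @ m # zs))"
    using assms by (subst sum.Sigma) (auto simp: split_def)
  also have "\<dots> = (\<Sum>B\<in>Pow A. \<Sum>ys\<in>permutations_of_set B. \<Sum>zs\<in>permutations_of_set (A - B). g (ys @ m # zs))"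
    by (simp add: sum.cartesian_product)
  finally show ?thesis .
qed

lemma sum_Pow_card:
  fixes g :: "nat \<Rightarrow> 'a :: comm_semiring_1"
  assumes "finite A"
  shows "(\<Sum>B\<in>Pow A. g (card B)) = (\<Sum>k\<le>card A. of_nat (card A choose k) * g k)"
proof -
  have "(\<Sum>B\<in>Pow A. g (card B)) = (\<Sum>k\<le>card A. \<Sum>B | B \<in> Pow A \<and> card B = k. g (card B))"
    using assms by (intro sum.group[symmetric]) (auto intro: card_mono)
  also have "\<dots> = (\<Sum>k\<le>card A. of_nat (card A choose k) * g k)"
  proof (rule sum.cong[OF refl])
    fix k
    have "(\<Sum>B | B \<in> Pow A \<and> card B = k. g (card B)) = (\<Sum>B | B \<subseteq> A \<and> card B = k. g k)"
      by (rule sum.cong) auto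
    then show "(\<Sum>B | B \<in> Pow A \<and> card B = k. g (card B)) = of_nat (card A choose k) * g k"
      using n_subsets[OF assms, of k] by simp
  qed
  finally show ?thesis .
qed

text \<open>
  Cut at the maximum \<open>m\<close>: it is preceded by an ascent and followed by a descent, unless it is
  the first or the last entry; the two exceptions are the conditionals.
\<close>

lemma eulerian_Suc:
  fixes a b :: "'a :: comm_ring_1"
  shows "eulerian a b (Suc m) = (\<Sum>k\<le>m. of_nat (m choose k)
     * ((if k = 0 then 1 else a * eulerian a b k) * (if m - k = 0 then 1 else b * eulerian a b (m - k))))"
proof -
  let ?P = "\<lambda>B. permutations_of_set B :: nat list set"
  let ?L = "\<lambda>k. if k = 0 then 1 else a * eulerian a b k"
  let ?R = "\<lambda>k. if k = 0 then 1 else b * eulerian a b k"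
  have part: "(\<Sum>ys\<in>?P B. if ys = [] then 1 else c * path_weight a b ys)
      = (if card B = 0 then 1 else c * eulerian a b (card B))" if "finite B" for B c
  proof (cases "B = {}")
    case False
    then have "(\<Sum>ys\<in>?P B. if ys = [] then 1 else c * path_weight a b ys)
        = (\<Sum>ys\<in>?P B. c * path_weight a b ys)"
      by (intro sum.cong) (auto dest: permutations_of_setD)
    then show ?thesis
      using False that by (simp add: sum_distrib_left[symmetric] sum_path_weight_eq_eulerian)
  qed simp
  have "eulerian a b (Suc m) = (\<Sum>B\<in>Pow {..<m}. \<Sum>ys\<in>?P B. \<Sum>zs\<in>?P ({..<m} - B). path_weight a b (ys @ m # zs))"
    unfolding eulerian_def lessThan_Suc by (rule sum_permutations_split_at) auto
  also have "\<dots> = (\<Sum>B\<in>Pow {..<m}. ?L (card B) * ?R (m - card B))"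
  proof (rule sum.cong[OF refl])
    fix B assume B: "B \<in> Pow {..<m}"
    then have fin: "finite B" by (auto intro: finite_subset)
    have card: "card ({..<m} - B) = m - card B"
      using B fin by (subst card_Diff_subset) auto
    have "(\<Sum>ys\<in>?P B. \<Sum>zs\<in>?P ({..<m} - B). path_weight a b (ys @ m # zs))
      = (\<Sum>ys\<in>?P B. \<Sum>zs\<in>?P ({..<m} - B). (if ys = [] then 1 else a * path_weight a b ys)
           * (if zs = [] then 1 else b * path_weight a b zs))"
    proof (intro sum.cong refl)
      fix ys zs assume "ys \<in> ?P B" "zs \<in> ?P ({..<m} - B)"
      then have "\<forall>x\<in>set ys. x < m" "\<forall>x\<in>set zs. x < m"
        using B by (auto dest: permutations_of_setD)
      then show "path_weight a b (ys @ m # zs) = (if ys = [] then 1 else a * path_weight a b ys)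
           * (if zs = [] then 1 else b * path_weight a b zs)"
        by (subst path_weight_append) (simp only: path_weight_max_Cons path_weight_max_snoc)
    qed
    also have "\<dots> = ?L (card B) * ?R (m - card B)"
      by (simp only: sum_product[symmetric] part[OF fin] part[of "{..<m} - B"] card
            finite_Diff finite_lessThan)
    finally show "(\<Sum>ys\<in>?P B. \<Sum>zs\<in>?P ({..<m} - B). path_weight a b (ys @ m # zs))
        = ?L (card B) * ?R (m - card B)" .
  qed
  also have "\<dots> = (\<Sum>k\<le>m. of_nat (m choose k) * (?L k * ?R (m - k)))"
    using sum_Pow_card[of "{..<m}" "\<lambda>k. ?L k * ?R (m - k)"] by simp
  finally show ?thesis .
qed


lemma path_weight_rev:
  "distinct xs \<Longrightarrow> path_weight a b (rev xs) = path_weight b a xs"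
proof (induction b a xs rule: path_weight.induct)
  case (1 b a x y xs)
  have "path_weight a b (rev (x # y # xs)) = path_weight a b (rev (y # xs)) * step_weight a b y x"
    using path_weight_append[of a b "rev xs" y "[x]"] by simp
  moreover have "step_weight a b y x = step_weight b a x y"
    using 1(2) by (auto simp: step_weight_def)
  ultimately show ?case using 1 by (simp add: mult.commute)
qed simp_all

text \<open>
  Reversal exchanges ascents and descents.
\<close>

lemma eulerian_commute: "eulerian a b m = eulerian b a m"
proof -
  have "eulerian a b m = (\<Sum>xs\<in>rev ` permutations_of_set {..<m}. path_weight a b xs)"
    by (simp add: eulerian_def)
  also have "\<dots> = (\<Sum>xs\<in>permutations_of_set {..<m}. path_weight a b (rev xs))"
    by (subst sum.reindex) (simp_all add: inj_on_def)
  also have "\<dots> = eulerian b a m"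
    unfolding eulerian_def
    by (rule sum.cong) (simp_all add: permutations_of_set_def path_weight_rev)
  finally show ?thesis .
qed

section \<open>The exponential generating function\<close>

text \<open>
  The series starts at \<open>m = 1\<close>; the empty permutation is the \<open>1\<close> in \<open>1 + a F\<close> below.
\<close>

definition eulerian_egf :: "'a :: field_char_0 \<Rightarrow> 'a \<Rightarrow> 'a fps" where
  "eulerian_egf a b = Abs_fps (\<lambda>m. if m = 0 then 0 else eulerian a b m / fact m)"

text \<open>
  The recursion of \<open>eulerian_Suc\<close> is a binomial convolution, and the two conditionals in it are
  the coefficients of the two factors.
\<close>

lemma deriv_eulerian_egf:
  "fps_deriv (eulerian_egf a b) =
     (1 + fps_const a * eulerian_egf a b) * (1 + fps_const b * eulerian_egf a b)"
proof (rule fps_ext)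
  fix m
  let ?L = "\<lambda>k. if k = 0 then 1 else a * eulerian a b k"
  let ?R = "\<lambda>k. if k = 0 then 1 else b * eulerian a b k"
  have coeff: "(1 + fps_const c * eulerian_egf a b) $ k
      = (if k = 0 then 1 else c * eulerian a b k) / fact k" for c k
    by (simp add: eulerian_egf_def)
  have "fps_deriv (eulerian_egf a b) $ m = of_nat (Suc m) * eulerian a b (Suc m) / fact (Suc m)"
    by (simp add: eulerian_egf_def)
  also have "\<dots> = eulerian a b (Suc m) / fact m"
    by (subst fact_Suc) (simp del: of_nat_Suc)
  also have "\<dots> = (\<Sum>k\<le>m. (?L k / fact k) * (?R (m - k) / fact (m - k)))"
    unfolding eulerian_Suc sum_divide_distrib
    by (intro sum.cong refl) (simp only: binomial_fact atMost_iff times_divide_times_eq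
          times_divide_eq_left nonzero_divide_eq_eq divide_divide_eq_left fact_nonzero mult_ac
          , simp add: field_simps)
  also have "\<dots> = ((1 + fps_const a * eulerian_egf a b) * (1 + fps_const b * eulerian_egf a b)) $ m"
    unfolding fps_mult_nth coeff by (simp add: atMost_atLeast0)
  finally show "fps_deriv (eulerian_egf a b) $ m
    = ((1 + fps_const a * eulerian_egf a b) * (1 + fps_const b * eulerian_egf a b)) $ m" .
qed

text \<open>
  For \<open>U = 1 + a F\<close> and \<open>V = 1 + b F\<close> the equation \<open>F' = U V\<close> gives
  \<open>(V / U)' = V (b U - a V) / U = (b - a) V / U\<close>, since \<open>b U - a V = b - a\<close>. So \<open>V / U\<close> is an
  exponential, and \<open>F\<close> is a linear fractional function of it.
\<close>

lemma eulerian_egf_eq: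
  fixes a b :: "'a :: field_char_0"
  assumes "a \<noteq> b"
  shows "eulerian_egf a b =
    (fps_exp (b - a) - 1) / (fps_const (b - a) - fps_const a * (fps_exp (b - a) - 1))"
proof -
  define F where "F = eulerian_egf a b"
  define U where "U = 1 + fps_const a * F"
  define V where "V = 1 + fps_const b * F"
  have F0: "F $ 0 = 0" by (simp add: F_def eulerian_egf_def)
  have U0: "U $ 0 = 1" and V0: "V $ 0 = 1" by (simp_all add: U_def V_def F0)
  have dF: "fps_deriv F = U * V" unfolding F_def U_def V_def by (rule deriv_eulerian_egf)
  define W where "W = V * inverse U"
  have UW: "V = W * U" using U0 by (simp add: W_def mult.assoc inverse_mult_eq_1)
  have dU: "fps_deriv U = fps_const a * (U * V)" and dV: "fps_deriv V = fps_const b * (U * V)"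
    by (simp_all add: U_def V_def dF[unfolded U_def V_def])
  have "fps_deriv W * U + W * fps_deriv U = fps_deriv V"
    unfolding UW by (simp add: algebra_simps)
  then have "fps_deriv W * U = V * (fps_const b * U - fps_const a * V)"
    unfolding dU dV by (simp add: right_diff_distrib diff_eq_eq eq_diff_eq UW mult_ac)
  also have "fps_const b * U - fps_const a * V = fps_const (b - a)"
  proof -
    have "B * (1 + A * F) - A * (1 + B * F) = B - A" for A B :: "'a fps"
      by (simp add: algebra_simps)
    then show ?thesis by (simp add: U_def V_def)
  qed
  finally have "(fps_deriv W - fps_const (b - a) * W) * U = 0"
    unfolding UW by (simp add: left_diff_distrib right_diff_distrib mult_ac)
  moreover have "U \<noteq> 0" using U0 by auto
  ultimately have ODE: "fps_deriv W = fps_const (b - a) * W" by simp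
  have "W $ 0 = 1" using U0 V0 by (simp add: W_def)
  then have "W = fps_exp (b - a)"
    using ODE fps_exp_unique_ODE[of W "b - a"] by (metis fps_const_1_eq_1 mult_1)
  then have "1 + fps_const b * F = fps_exp (b - a) * (1 + fps_const a * F)"
    using UW by (simp add: U_def V_def)
  moreover have "F * (B - A - A * (E - 1)) = E - 1" if "1 + B * F = E * (1 + A * F)" for A B E :: "'a fps"
  proof -
    have "F * (B - A - A * (E - 1)) = (1 + B * F) - E * (A * F) - 1" by (simp add: algebra_simps)
    also have "\<dots> = E - 1" unfolding that by (simp add: algebra_simps)
    finally show ?thesis .
  qed
  ultimately have "F * (fps_const b - fps_const a - fps_const a * (fps_exp (b - a) - 1)) = fps_exp (b - a) - 1"
    by blast
  then have "F * (fps_const (b - a) - fps_const a * (fps_exp (b - a) - 1)) = fps_exp (b - a) - 1"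
    by simp
  moreover have "(fps_const (b - a) - fps_const a * (fps_exp (b - a) - 1)) $ 0 \<noteq> 0"
    using assms by simp
  ultimately show ?thesis
    unfolding F_def by (metis fps_zero_nth nonzero_mult_div_cancel_right)
qed

section \<open>Cyclic arrangements\<close>

lemma bij_betw_Suc_mod:
  assumes "0 < n"
  shows "bij_betw (\<lambda>i. Suc i mod n) {..<n} {..<n}"
proof -
  have "y \<in> (\<lambda>i. Suc i mod n) ` {..<n}" if "y < n" for y
    using that assms by (intro image_eqI[of _ _ "if y = 0 then n - 1 else y - 1"]) auto
  then have "(\<lambda>i. Suc i mod n) ` {..<n} = {..<n}" using assms by auto
  then show ?thesis unfolding bij_betw_def by (simp add: eq_card_imp_inj_on)
qed

lemma cycle_weight_rotate: "cycle_weight a b (rotate k xs) = cycle_weight a b xs"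
proof (induction k)
  case (Suc k)
  have rotate1: "cycle_weight a b (rotate1 ys) = cycle_weight a b ys" if "ys \<noteq> []" for ys
  proof -
    let ?n = "length ys"
    let ?g = "\<lambda>i. step_weight a b (ys ! i) (ys ! (Suc i mod ?n))"
    have "cycle_weight a b (rotate1 ys) = (\<Prod>i<?n. ?g (Suc i mod ?n))"
      unfolding cycle_weight_def length_rotate1
    proof (rule prod.cong[OF refl])
      fix i assume "i \<in> {..<?n}"
      then show "step_weight a b (rotate1 ys ! i) (rotate1 ys ! (Suc i mod ?n)) = ?g (Suc i mod ?n)"
        using that by (simp add: nth_rotate1)
    qed
    also have "\<dots> = (\<Prod>i<?n. ?g i)"
      using that by (intro prod.reindex_bij_betw bij_betw_Suc_mod) simp
    finally show ?thesis unfolding cycle_weight_def .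
  qed
  show ?case using Suc rotate1[of "rotate k xs"] by (cases "xs = []") auto
qed simp

lemma path_weight_eq_prod:
  "path_weight a b xs = (\<Prod>i<length xs - 1. step_weight a b (xs ! i) (xs ! Suc i))"
  by (induction a b xs rule: path_weight.induct)
     (simp_all add: prod.lessThan_Suc_shift del: prod.lessThan_Suc)

lemma cycle_weight_max_Cons:
  assumes "ws \<noteq> []" "\<forall>x\<in>set ws. x < m"
  shows "cycle_weight a b (m # ws) = a * b * path_weight a b ws"
proof -
  obtain l where l: "length ws = Suc l" using assms(1) by (cases ws) auto
  have "ws ! 0 < m" "ws ! l < m" using assms(2) l by (auto simp: nth_mem)
  then show ?thesis
    unfolding cycle_weight_def path_weight_eq_prod
    by (simp add: l prod.lessThan_Suc_shift[of _ "Suc l"] step_weight_def mult_ac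
        del: prod.lessThan_Suc)
       (simp add: mult_ac)
qed

text \<open>
  Every cyclic arrangement is a rotation of a unique one that starts with the maximum; the
  factor \<open>Suc m\<close> counts the rotations. The maximum is left by a descent and entered by an
  ascent, hence the factor \<open>a * b\<close>. For \<open>m = 0\<close> there is no such pair of steps.
\<close>

lemma sum_cycle_weight:
  assumes "0 < m"
  shows "(\<Sum>xs\<in>permutations_of_set {..<Suc m}. cycle_weight a b xs)
       = of_nat (Suc m) * (a * b * eulerian a b m)"
proof -
  let ?S = "{..<Suc m} \<times> permutations_of_set {..<m}"
  let ?f = "\<lambda>(k, ws). rotate k (m # ws)"
  have len: "length ws = m" if "ws \<in> permutations_of_set {..<m}" for ws
    using length_finite_permutations_of_set[OF that] by simp
  have inj: "inj_on ?f ?S"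
  proof (rule inj_onI, clarify)
    fix k ws l us
    assume k: "k < Suc m" and l: "l < Suc m" and ws: "ws \<in> permutations_of_set {..<m}"
      and us: "us \<in> permutations_of_set {..<m}" and eq: "rotate k (m # ws) = rotate l (m # us)"
    have dist: "distinct (m # us)" using us by (simp add: permutations_of_set_def)
    \<comment> \<open>The position of the maximum after rotation by \<open>k\<close>, so that equal lists have equal \<open>k\<close>.\<close>
    let ?i = "(Suc m - k) mod Suc m"
    have "rotate k (m # ws) ! ?i = (m # ws) ! ((k + (Suc m - k)) mod Suc m)"
      using len[OF ws] by (subst nth_rotate) (simp_all add: mod_simps)
    moreover have "rotate l (m # us) ! ?i = (m # us) ! ((l + (Suc m - k)) mod Suc m)"
      using len[OF us] by (subst nth_rotate) (simp_all add: mod_simps)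
    ultimately have "(m # us) ! ((l + (Suc m - k)) mod Suc m) = (m # us) ! 0"
      using eq k by simp
    then have "(l + (Suc m - k)) mod Suc m = 0"
      using nth_eq_iff_index_eq[OF dist, of "(l + (Suc m - k)) mod Suc m" 0] len[OF us] by simp
    moreover have "(l + (Suc m - k)) mod Suc m = (if l < k then l + (Suc m - k) else l - k)"
    proof (cases "l < k")
      case False
      then have "l + (Suc m - k) = (l - k) + Suc m" using k by simp
      then show ?thesis
        using False l by (simp only: mod_add_self2 if_False mod_less less_imp_diff_less)
    qed (use k in simp)
    ultimately have "k = l" using k by (simp split: if_splits)
    moreover have "inj (rotate k :: nat list \<Rightarrow> _)"
      using inj_fn[OF inj_rotate1] by (simp add: rotate_def)
    ultimately show "k = l \<and> ws = us" using eq by (auto dest: injD)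
  qed
  have "rotate k (m # ws) \<in> permutations_of_set {..<Suc m}" if "ws \<in> permutations_of_set {..<m}" for k ws
    using that unfolding permutations_of_set_def by (simp add: lessThan_Suc)
  then have "?f ` ?S \<subseteq> permutations_of_set {..<Suc m}" by auto
  moreover have "card (?f ` ?S) = card (permutations_of_set {..<Suc m})"
    by (simp add: card_image[OF inj] card_cartesian_product)
  ultimately have img: "?f ` ?S = permutations_of_set {..<Suc m}"
    by (intro card_subset_eq finite_permutations_of_set)
  have "(\<Sum>xs\<in>permutations_of_set {..<Suc m}. cycle_weight a b xs)
      = (\<Sum>t\<in>?S. cycle_weight a b (?f t))"
    using sum.reindex[OF inj, of "cycle_weight a b"] img by simp
  also have "\<dots> = (\<Sum>(k, ws)\<in>?S. a * b * path_weight a b ws)"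
  proof (rule sum.cong[OF refl], clarify)
    fix k ws assume ws: "ws \<in> permutations_of_set {..<m}"
    then have "ws \<noteq> []" using len assms by fastforce
    then show "cycle_weight a b (rotate k (m # ws)) = a * b * path_weight a b ws"
      using ws by (auto simp: cycle_weight_rotate cycle_weight_max_Cons dest: permutations_of_setD)
  qed
  also have "\<dots> = of_nat (Suc m) * (a * b * eulerian a b m)"
    by (simp add: sum.cartesian_product[symmetric] eulerian_def sum_distrib_left)
  finally show ?thesis .
qed

section \<open>Seatings in which every guest gets a napkin\<close>

text \<open>
  The flag \<open>s\<close> is \<open>True\<close> for the left, as for preferences. Treating both sides at once turns
  the mirror symmetry of the table into a parameter.
\<close>

definition side_napkin :: "nat \<Rightarrow> bool \<Rightarrow> nat \<Rightarrow> nat" where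
  "side_napkin n s i = (if s then left_napkin n i else right_napkin n i)"

text \<open>
  The place whose napkin on side \<open>s\<close> is the napkin of \<open>i\<close> on the opposite side; so
  for \<open>s = True\<close> it is the place to the right of \<open>i\<close>.
\<close>

definition neighbour :: "nat \<Rightarrow> bool \<Rightarrow> nat \<Rightarrow> nat" where
  "neighbour n s i = (if s then Suc i mod n else (i + n - 1) mod n)"

lemma preferred_napkin_eq: "preferred_napkin n pref i = side_napkin n (pref i) i"
  and other_napkin_eq: "other_napkin n pref i = side_napkin n (\<not> pref i) i"
  by (simp_all add: preferred_napkin_def other_napkin_def side_napkin_def)

lemma Suc_mod_eq: "i < n \<Longrightarrow> Suc i mod n = (if Suc i = n then 0 else Suc i)"
  by auto

lemma inj_on_side_napkin: "inj_on (side_napkin n s) {..<n}"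
  by (auto simp: inj_on_def side_napkin_def left_napkin_def right_napkin_def Suc_mod_eq
      split: if_splits)

lemma side_napkin_neighbour:
  assumes "i < n"
  shows "side_napkin n (\<not> s) i = side_napkin n s (neighbour n s i)"
proof (cases s)
  case False
  have "Suc (i + n - 1) mod n = i" using assms by simp
  then show ?thesis using False
    by (simp add: side_napkin_def neighbour_def left_napkin_def right_napkin_def mod_Suc_eq)
qed (simp add: side_napkin_def neighbour_def left_napkin_def right_napkin_def)

lemma neighbour_less: "i < n \<Longrightarrow> neighbour n s i < n"
  by (simp add: neighbour_def)

lemma neighbour_neq:
  assumes "2 \<le> n" "i < n"
  shows "neighbour n s i \<noteq> i"
proof (cases s)
  case False
  show ?thesis
  proof (cases "i = 0")
    case False
    then have "i + n - 1 = (i - 1) + n" by simp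
    then have "(i + n - 1) mod n = i - 1" using assms by (simp only: mod_add_self2) simp
    then show ?thesis using False \<open>\<not> s\<close> by (simp add: neighbour_def)
  qed (use False assms in \<open>simp add: neighbour_def\<close>)
qed (use assms in \<open>simp add: neighbour_def Suc_mod_eq\<close>)

text \<open>
  The situation after every guest outside \<open>S\<close> has taken his napkin on side \<open>s\<close>: the guest \<open>i\<close>
  follows suit unless he prefers the opposite napkin and finds it, that is, unless
  the neighbour who would use that napkin is still to come.
\<close>

lemma take_napkin_side_iff:
  assumes n: "2 \<le> n" and S: "S \<subseteq> {..<n}" and i: "i \<in> S"
  shows "take_napkin n pref (side_napkin n s ` S) i = Some (side_napkin n s i)
    \<longleftrightarrow> pref i = s \<or> neighbour n s i \<notin> S"
proof (cases "pref i = s")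
  case False
  then have pref: "pref i \<longleftrightarrow> \<not> s" by blast
  have lt: "i < n" "neighbour n s i < n" using S i by (auto intro: neighbour_less)
  have "side_napkin n s (neighbour n s i) \<in> side_napkin n s ` S \<longleftrightarrow> neighbour n s i \<in> S"
    using inj_on_image_mem_iff[OF inj_on_side_napkin _ S] lt by simp
  moreover have "side_napkin n s (neighbour n s i) \<noteq> side_napkin n s i"
    using inj_on_eq_iff[OF inj_on_side_napkin, of "neighbour n s i" n i s] lt neighbour_neq[OF n lt(1)]
    by simp
  ultimately show ?thesis
    using False i unfolding take_napkin_def preferred_napkin_eq other_napkin_eq pref
      side_napkin_neighbour[OF lt(1), of s] by simp
qed (use i in \<open>simp add: take_napkin_def preferred_napkin_eq\<close>)

text \<open>
  The set of remaining napkins is generalized to those on side \<open>s\<close> of the guests still to come,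
  which is what remains as long as everybody has taken side \<open>s\<close>; this makes the induction over
  the seating order work.
\<close>

lemma seat_guests_side_iff:
  assumes n: "2 \<le> n"
  shows "\<lbrakk>distinct is; set is \<subseteq> {..<n}\<rbrakk> \<Longrightarrow>
    (\<forall>i\<in>set is. seat_guests n pref is (side_napkin n s ` set is) i = Some (side_napkin n s i))
    \<longleftrightarrow> (\<forall>k<length is. pref (is ! k) = s \<or> neighbour n s (is ! k) \<notin> set (drop (Suc k) is))"
proof (induction "is")
  case (Cons i "is")
  let ?A = "side_napkin n s ` set (i # is)"
  have i: "i < n" "i \<notin> set is" and dist: "distinct is" "set is \<subseteq> {..<n}" using Cons.prems by auto
  have head: "take_napkin n pref ?A i = Some (side_napkin n s i)
      \<longleftrightarrow> pref i = s \<or> neighbour n s i \<notin> set is"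
    using take_napkin_side_iff[OF n Cons.prems(2), of i pref s] neighbour_neq[OF n i(1), of s] by simp
  have rest: "?A - {side_napkin n s i} = side_napkin n s ` set is"
    using i dist inj_on_side_napkin[of n s] by (auto simp: inj_on_def)
  have first: "seat_guests n pref (i # is) ?A i = take_napkin n pref ?A i"
    by (simp only: seat_guests.simps fun_upd_same)
  have later: "seat_guests n pref (i # is) ?A j = seat_guests n pref is (side_napkin n s ` set is) j"
    if "take_napkin n pref ?A i = Some (side_napkin n s i)" "j \<in> set is" for j
  proof -
    have "j \<noteq> i" using that(2) i(2) by blast
    then show ?thesis by (simp only: seat_guests.simps that(1) option.set rest fun_upd_other not_False_eq_True)
  qed
  have ball: "(\<forall>j\<in>set (i # is). P j) \<longleftrightarrow> P i \<and> (\<forall>j\<in>set is. P j)" for P by simp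
  have "(\<forall>j\<in>set (i # is). seat_guests n pref (i # is) ?A j = Some (side_napkin n s j))
      \<longleftrightarrow> take_napkin n pref ?A i = Some (side_napkin n s i)
        \<and> (\<forall>j\<in>set is. seat_guests n pref is (side_napkin n s ` set is) j = Some (side_napkin n s j))"
    unfolding ball[of "\<lambda>j. seat_guests n pref (i # is) ?A j = Some (side_napkin n s j)"] first
    by (rule conj_cong[OF refl], rule ball_cong[OF refl], subst later) (rule refl | assumption)+
  also have "\<dots> \<longleftrightarrow> (pref i = s \<or> neighbour n s i \<notin> set is)
        \<and> (\<forall>k<length is. pref (is ! k) = s \<or> neighbour n s (is ! k) \<notin> set (drop (Suc k) is))"
    unfolding head Cons.IH[OF dist] ..
  also have "\<dots> \<longleftrightarrow> (\<forall>k<length (i # is). pref ((i # is) ! k) = s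
        \<or> neighbour n s ((i # is) ! k) \<notin> set (drop (Suc k) (i # is)))"
    unfolding length_Cons All_less_Suc2 by simp
  finally show ?case .
qed simp

lemma take_napkin_SomeD:
  "take_napkin n pref A i = Some x \<Longrightarrow> x \<in> A \<and> (\<exists>s. x = side_napkin n s i)"
  by (auto simp: take_napkin_def preferred_napkin_eq other_napkin_eq split: if_splits)

lemma seat_guests_SomeD:
  "seat_guests n pref is A i = Some x \<Longrightarrow> x \<in> A \<and> (\<exists>s. x = side_napkin n s i)"
  by (induction "is" arbitrary: A) (auto dest: take_napkin_SomeD split: if_splits)

lemma seat_guests_distinct_napkins:
  "seat_guests n pref is A i = Some x \<Longrightarrow> seat_guests n pref is A j = Some x \<Longrightarrow> i = j"
proof (induction "is" arbitrary: A)
  case (Cons k "is")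
  show ?case
  proof (cases "k = i \<or> k = j")
    case True
    then show ?thesis using Cons.prems by (auto dest!: seat_guests_SomeD split: if_splits)
  next
    case False
    then show ?thesis using Cons.prems Cons.IH by auto
  qed
qed simp

text \<open>
  A guest who takes his right napkin deprives his right neighbour of the left one; a neighbour
  who is served must thus take his right napkin too, and this propagates around the table.
\<close>

lemma all_served_iff:
  assumes n: "2 \<le> n"
  shows "(\<forall>i<n. napkin_of n ord pref i \<noteq> None) \<longleftrightarrow>
    (\<exists>s. \<forall>i<n. napkin_of n ord pref i = Some (side_napkin n s i))"
proof
  assume all: "\<forall>i<n. napkin_of n ord pref i \<noteq> None"
  have sides: "napkin_of n ord pref i = Some (side_napkin n True i)
      \<or> napkin_of n ord pref i = Some (side_napkin n False i)" if "i < n" for i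
    using all that seat_guests_SomeD[of n pref ord "{..<n}" i] unfolding napkin_of_def
    by (metis (full_types) option.exhaust)
  show "\<exists>s. \<forall>i<n. napkin_of n ord pref i = Some (side_napkin n s i)"
  proof (cases "\<forall>i<n. napkin_of n ord pref i = Some (side_napkin n True i)")
    case False
    then obtain i where i: "i < n" "napkin_of n ord pref i = Some (side_napkin n False i)"
      using sides by blast
    have step: "napkin_of n ord pref (Suc j mod n) = Some (side_napkin n False (Suc j mod n))"
      if j: "j < n" "napkin_of n ord pref j = Some (side_napkin n False j)" for j
    proof -
      have "side_napkin n False j = side_napkin n True (Suc j mod n)"
        by (simp add: side_napkin_def left_napkin_def right_napkin_def)
      moreover have "Suc j mod n \<noteq> j" using j n by (simp add: Suc_mod_eq)
      ultimately have "napkin_of n ord pref (Suc j mod n) \<noteq> Some (side_napkin n True (Suc j mod n))"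
        using j(2) seat_guests_distinct_napkins unfolding napkin_of_def by metis
      then show ?thesis using sides[of "Suc j mod n"] j by simp
    qed
    have right: "napkin_of n ord pref ((i + k) mod n) = Some (side_napkin n False ((i + k) mod n))" for k
    proof (induction k)
      case (Suc k)
      then show ?case using step[of "(i + k) mod n"] i by (simp add: mod_Suc_eq)
    qed (use i in simp)
    have "napkin_of n ord pref j = Some (side_napkin n False j)" if "j < n" for j
      using right[of "n - i + j"] i that by simp
    then show ?thesis by blast
  qed blast
qed auto

text \<open>
  The inverse permutation of the seating order: entry \<open>i\<close> is the time at which place \<open>i\<close> is
  occupied. Neighbours at the table become cyclically adjacent entries.
\<close>

definition seating_times :: "nat \<Rightarrow> nat list \<Rightarrow> nat list" where
  "seating_times n ord = map (the_inv_into {..<n} ((!) ord)) [0..<n]"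

lemma seating_times_props:
  assumes "ord \<in> permutations_of_set {..<n}"
  shows "seating_times n ord \<in> permutations_of_set {..<n}"
    and "k < n \<Longrightarrow> seating_times n ord ! (ord ! k) = k"
proof -
  have ord: "set ord = {..<n}" "distinct ord" "length ord = n"
    using assms length_finite_permutations_of_set[OF assms] by (auto dest: permutations_of_setD)
  have bij: "bij_betw ((!) ord) {..<n} {..<n}" using ord by (intro bij_betw_nth) auto
  have bij': "bij_betw (the_inv_into {..<n} ((!) ord)) {..<n} {..<n}"
    by (rule bij_betw_the_inv_into[OF bij])
  then have "inj_on (the_inv_into {..<n} ((!) ord)) {..<n}"
    and "the_inv_into {..<n} ((!) ord) ` {..<n} = {..<n}"
    by (auto simp: bij_betw_def)
  then show "seating_times n ord \<in> permutations_of_set {..<n}"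
    unfolding permutations_of_set_def seating_times_def
    by (simp add: distinct_map lessThan_atLeast0)
  assume k: "k < n"
  have "ord ! k < n" using bij_betwE[OF bij] k by auto
  then show "seating_times n ord ! (ord ! k) = k"
    unfolding seating_times_def using k bij by (simp add: the_inv_into_f_f bij_betw_def)
qed

lemma bij_betw_seating_times:
  "bij_betw (seating_times n) (permutations_of_set {..<n}) (permutations_of_set {..<n})"
proof -
  have "inj_on (seating_times n) (permutations_of_set {..<n})"
  proof (rule inj_onI)
    fix u v
    assume u: "u \<in> permutations_of_set {..<n}" and v: "v \<in> permutations_of_set {..<n}"
      and eq: "seating_times n u = seating_times n v"
    note times = permutations_of_setD[OF seating_times_props(1)[OF v]]
    have len: "length u = n" "length v = n" "length (seating_times n v) = n"
      using length_finite_permutations_of_set[OF u] length_finite_permutations_of_set[OF v]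
      by (simp_all add: seating_times_def)
    show "u = v"
    proof (rule nth_equalityI)
      fix k assume "k < length u"
      then have k: "k < n" using len by simp
      then have "u ! k < n" "v ! k < n"
        using len nth_mem[of k u] nth_mem[of k v] permutations_of_setD(1)[OF u] permutations_of_setD(1)[OF v]
        by auto
      then show "u ! k = v ! k"
        using seating_times_props(2)[OF u k] seating_times_props(2)[OF v k] eq times(2) len
        by (metis nth_eq_iff_index_eq)
    qed (use len in simp)
  qed
  moreover have "seating_times n ` permutations_of_set {..<n} \<subseteq> permutations_of_set {..<n}"
    using seating_times_props(1) by blast
  ultimately show ?thesis by (simp add: bij_betw_def endo_inj_surj)
qed

lemma all_side_iff_times:
  assumes n: "2 \<le> n" and ord: "ord \<in> permutations_of_set {..<n}"
  shows "(\<forall>i<n. napkin_of n ord pref i = Some (side_napkin n s i)) \<longleftrightarrow>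
    (\<forall>i<n. pref i = s \<or> seating_times n ord ! neighbour n s i < seating_times n ord ! i)"
proof -
  let ?t = "seating_times n ord"
  have props: "set ord = {..<n}" "distinct ord" "length ord = n"
    using ord length_finite_permutations_of_set[OF ord] by (auto dest: permutations_of_setD)
  have "side_napkin n s ` {..<n} = {..<n}"
    using n by (intro endo_inj_surj inj_on_side_napkin)
      (auto simp: side_napkin_def left_napkin_def right_napkin_def)
  then have "(\<forall>i<n. napkin_of n ord pref i = Some (side_napkin n s i)) \<longleftrightarrow>
    (\<forall>k<n. pref (ord ! k) = s \<or> neighbour n s (ord ! k) \<notin> set (drop (Suc k) ord))"
    using seat_guests_side_iff[OF n, of ord pref s] props by (simp add: napkin_of_def Ball_def)
  also have "\<dots> \<longleftrightarrow> (\<forall>k<n. pref (ord ! k) = s \<or> ?t ! neighbour n s (ord ! k) < ?t ! (ord ! k))"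
  proof -
    have "neighbour n s (ord ! k) \<notin> set (drop (Suc k) ord) \<longleftrightarrow>
        ?t ! neighbour n s (ord ! k) < ?t ! (ord ! k)" if k: "k < n" for k
    proof -
      have ok: "ord ! k < n" using props k nth_mem[of k ord] by auto
      obtain l where l: "l < n" "neighbour n s (ord ! k) = ord ! l"
        using neighbour_less[OF ok, of s] props by (metis in_set_conv_nth lessThan_iff)
      have "l \<noteq> k" using neighbour_neq[OF n ok, of s] l by auto
      have "ord ! l \<in> set (drop (Suc k) ord) \<longleftrightarrow> k < l"
      proof
        assume "ord ! l \<in> set (drop (Suc k) ord)"
        then obtain i where "i < n - Suc k" "ord ! (Suc k + i) = ord ! l"
          using props by (auto simp: in_set_conv_nth)
        then show "k < l" using props l by (auto simp: nth_eq_iff_index_eq)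
      next
        assume "k < l"
        then have "drop (Suc k) ord ! (l - Suc k) = ord ! l" "l - Suc k < length (drop (Suc k) ord)"
          using props l by auto
        then show "ord ! l \<in> set (drop (Suc k) ord)" by (metis nth_mem)
      qed
      then show ?thesis
        using l k \<open>l \<noteq> k\<close> by (auto simp: seating_times_props(2)[OF ord])
    qed
    then show ?thesis by auto
  qed
  also have "\<dots> \<longleftrightarrow> (\<forall>i<n. pref i = s \<or> ?t ! neighbour n s i < ?t ! i)"
  proof -
    have "(\<forall>i<n. P i) \<longleftrightarrow> (\<forall>k<n. P (ord ! k))" for P
      using all_set_conv_all_nth[of ord P] unfolding props(1,3) Ball_def lessThan_iff .
    from this[of "\<lambda>i. pref i = s \<or> ?t ! neighbour n s i < ?t ! i"] show ?thesis by (rule sym)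
  qed
  finally show ?thesis .
qed

lemma frustrated_iff:
  assumes n: "2 \<le> n" and i: "i < n" and "napkin_of n ord pref i = Some (side_napkin n s i)"
  shows "frustrated n ord pref i \<longleftrightarrow> pref i \<noteq> s"
proof -
  have "side_napkin n True i \<noteq> side_napkin n False i"
    using n i by (simp add: side_napkin_def left_napkin_def right_napkin_def Suc_mod_eq)
  then show ?thesis using assms(3)
    unfolding frustrated_def preferred_napkin_eq by (cases s; cases "pref i") auto
qed

text \<open>
  For seating times \<open>xs\<close>, the guests whose napkin opposite to side \<open>s\<close> is taken before they
  arrive, provided that all take side \<open>s\<close>. For \<open>s = True\<close> these are the cyclic descents of \<open>xs\<close>.
\<close>

definition displaced :: "bool \<Rightarrow> nat list \<Rightarrow> nat set" where
  "displaced s xs = {i. i < length xs \<and> xs ! neighbour (length xs) s i < xs ! i}"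

text \<open>
  The preferences for which, given the displaced guests \<open>D\<close>, all take side \<open>s\<close> and \<open>j\<close> of them
  are frustrated; see \<open>side_event_iff\<close>.
\<close>

definition side_event :: "nat \<Rightarrow> nat \<Rightarrow> bool \<Rightarrow> nat set \<Rightarrow> (nat \<Rightarrow> bool) set" where
  "side_event n j s D = {pref. (\<forall>i<n. pref i = s \<or> i \<in> D) \<and> card {i. i < n \<and> pref i \<noteq> s} = j}"

lemma side_event_iff:
  assumes n: "2 \<le> n" and ord: "ord \<in> permutations_of_set {..<n}"
  shows "pref \<in> side_event n j s (displaced s (seating_times n ord)) \<longleftrightarrow>
    (\<forall>i<n. napkin_of n ord pref i = Some (side_napkin n s i)) \<and> card {i. i < n \<and> frustrated n ord pref i} = j"
proof -
  have "(\<forall>i<n. pref i = s \<or> i \<in> displaced s (seating_times n ord)) \<longleftrightarrow>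
      (\<forall>i<n. napkin_of n ord pref i = Some (side_napkin n s i))"
    unfolding all_side_iff_times[OF n ord] displaced_def by (simp add: seating_times_def)
  moreover have "{i. i < n \<and> frustrated n ord pref i} = {i. i < n \<and> pref i \<noteq> s}"
    if "\<forall>i<n. napkin_of n ord pref i = Some (side_napkin n s i)"
    using that frustrated_iff[OF n] by blast
  ultimately show ?thesis unfolding side_event_def by auto
qed

section \<open>Probabilities\<close>

lemma prob_pair_pmf_of_set:
  assumes "finite X" "X \<noteq> {}"
  shows "measure_pmf.prob (pair_pmf (pmf_of_set X) M) E
    = (\<Sum>x\<in>X. measure_pmf.prob M {y. (x, y) \<in> E}) / card X"
proof -
  have "ennreal (measure_pmf.prob (pair_pmf (pmf_of_set X) M) E)
      = (\<integral>\<^sup>+x. ennreal (measure_pmf.prob M {y. (x, y) \<in> E}) \<partial>measure_pmf (pmf_of_set X))"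
    by (simp add: pair_pmf_def map_pmf_def[symmetric] measure_pmf.emeasure_eq_measure[symmetric]
        vimage_def)
  also have "\<dots> = ennreal ((\<Sum>x\<in>X. measure_pmf.prob M {y. (x, y) \<in> E}) / card X)"
    using assms by (simp add: nn_integral_pmf_of_set sum_nonneg divide_ennreal[symmetric]
        card_gt_0_iff ennreal_of_nat_eq_real_of_nat)
  finally show ?thesis by (simp add: sum_nonneg)
qed

text \<open>
  The frustrated guests form an arbitrary subset of \<open>D\<close> of size \<open>j\<close>, which determines all
  preferences.
\<close>

lemma prob_side_event:
  fixes p :: real and s :: bool
  assumes p: "0 \<le> p" "p \<le> 1" and D: "D \<subseteq> {..<n}"
  defines "r \<equiv> if s then p else 1 - p"
  shows "measure_pmf.prob (Pi_pmf {..<n} False (\<lambda>_. bernoulli_pmf p)) (side_event n j s D)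
    = real (card D choose j) * r ^ (n - j) * (1 - r) ^ j"
proof -
  let ?M = "Pi_pmf {..<n} False (\<lambda>_. bernoulli_pmf p)"
  let ?T = "{T. T \<subseteq> D \<and> card T = j}"
  \<comment> \<open>The preferences with frustrated guests \<open>T\<close>; \<open>False\<close> is the default value of the
    product distribution outside the table.\<close>
  let ?F = "\<lambda>T i. i < n \<and> (if i \<in> T then \<not> s else s)"
  have fin: "finite D" using D by (rule finite_subset) simp
  have inj: "inj_on ?F ?T"
  proof (rule inj_onI)
    fix S T assume "S \<in> ?T" "T \<in> ?T" "?F S = ?F T"
    then have "S \<subseteq> {..<n}" "T \<subseteq> {..<n}" "\<And>i. i < n \<Longrightarrow> i \<in> S \<longleftrightarrow> i \<in> T"
      using D by (auto dest: fun_cong split: if_splits)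
    then show "S = T" by blast
  qed
  have "measure_pmf.prob ?M (side_event n j s D) = measure_pmf.prob ?M (?F ` ?T)"
  proof (rule measure_prob_cong_0)
    fix f assume f: "f \<in> side_event n j s D - ?F ` ?T"
    then have "{i. i < n \<and> f i \<noteq> s} \<in> ?T" by (auto simp: side_event_def)
    then have "f \<noteq> ?F {i. i < n \<and> f i \<noteq> s}" using f by blast
    then have "\<exists>i. i \<notin> {..<n} \<and> f i \<noteq> False" by (auto simp: fun_eq_iff split: if_splits)
    then show "pmf ?M f = 0" by (auto simp: pmf_Pi)
  next
    fix f assume f: "f \<in> ?F ` ?T - side_event n j s D"
    then obtain T where T: "T \<in> ?T" "f = ?F T" by blast
    then have "{i. i < n \<and> f i \<noteq> s} = T" using D by auto
    then have "f \<in> side_event n j s D" using T by (auto simp: side_event_def)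
    then show "pmf ?M f = 0" using f by blast
  qed
  also have "\<dots> = (\<Sum>T\<in>?T. pmf ?M (?F T))"
    using fin by (subst measure_measure_pmf_finite) (auto simp: sum.reindex[OF inj])
  also have "\<dots> = (\<Sum>T\<in>?T. r ^ (n - j) * (1 - r) ^ j)"
  proof (rule sum.cong[OF refl])
    fix T assume T: "T \<in> ?T"
    then have sub: "T \<subseteq> {..<n}" and card: "card T = j" using D by auto
    have "pmf ?M (?F T) = (\<Prod>i<n. if i \<in> T then 1 - r else r)"
      using p by (subst pmf_Pi') (auto simp: r_def intro!: prod.cong)
    also have "\<dots> = (1 - r) ^ j * r ^ card ({..<n} - T)"
      using sub card by (subst prod.If_cases) (simp_all add: Int_absorb1 Diff_eq)
    also have "card ({..<n} - T) = n - j"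
      using sub card by (subst card_Diff_subset) (auto intro: finite_subset)
    finally show "pmf ?M (?F T) = r ^ (n - j) * (1 - r) ^ j" by (simp add: mult.commute)
  qed
  also have "\<dots> = real (card D choose j) * r ^ (n - j) * (1 - r) ^ j"
    using n_subsets[OF fin, of j] by simp
  finally show ?thesis .
qed

lemma pr0_eq:
  assumes n: "2 \<le> n" and p: "0 \<le> p" "p \<le> 1"
  shows "pr0 p j n = (\<Sum>xs\<in>permutations_of_set {..<n}.
      real (card (displaced True xs) choose j) * p ^ (n - j) * (1 - p) ^ j
    + real (card (displaced False xs) choose j) * (1 - p) ^ (n - j) * p ^ j) / fact n"
proof -
  let ?X = "permutations_of_set {..<n}"
  let ?M = "Pi_pmf {..<n} False (\<lambda>_. bernoulli_pmf p)"
  let ?ev = "\<lambda>s ord. side_event n j s (displaced s (seating_times n ord))"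
  let ?h = "\<lambda>xs. real (card (displaced True xs) choose j) * p ^ (n - j) * (1 - p) ^ j
    + real (card (displaced False xs) choose j) * (1 - p) ^ (n - j) * p ^ j"
  let ?E = "{(ord, pref). (\<forall>i<n. napkin_of n ord pref i \<noteq> None) \<and>
                   card {i. i < n \<and> frustrated n ord pref i} = j}"
  have "measure_pmf.prob ?M {pref. (ord, pref) \<in> ?E} = ?h (seating_times n ord)"
    if ord: "ord \<in> ?X" for ord
  proof -
    \<comment> \<open>The two sides exclude each other because a guest at a table for at least two has
      two different napkins.\<close>
    have "{pref. (ord, pref) \<in> ?E} = ?ev True ord \<union> ?ev False ord"
      unfolding set_eq_iff Un_iff mem_Collect_eq prod.case side_event_iff[OF n ord]
        all_served_iff[OF n] ex_bool_eq by blast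
    moreover have "?ev True ord \<inter> ?ev False ord = {}"
    proof -
      have "side_napkin n True 0 \<noteq> side_napkin n False 0"
        using n by (simp add: side_napkin_def left_napkin_def right_napkin_def)
      moreover have "0 < n" using n by simp
      ultimately show ?thesis
        unfolding disjoint_iff side_event_iff[OF n ord] by (metis option.inject)
    qed
    ultimately have "measure_pmf.prob ?M {pref. (ord, pref) \<in> ?E}
        = measure_pmf.prob ?M (?ev True ord) + measure_pmf.prob ?M (?ev False ord)"
      by (simp add: measure_pmf.finite_measure_Union)
    moreover have "displaced s (seating_times n ord) \<subseteq> {..<n}" for s
      by (auto simp: displaced_def seating_times_def)
    ultimately show ?thesis by (simp add: prob_side_event[OF p])
  qed
  then have "pr0 p j n = (\<Sum>ord\<in>?X. ?h (seating_times n ord)) / fact n"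
    unfolding pr0_def table_pmf_def by (subst prob_pair_pmf_of_set) simp_all
  also have "(\<Sum>ord\<in>?X. ?h (seating_times n ord)) = (\<Sum>xs\<in>?X. ?h xs)"
    by (rule sum.reindex_bij_betw[OF bij_betw_seating_times])
  finally show ?thesis .
qed

section \<open>The generating function\<close>

text \<open>
  As entries are distinct, each cyclic step is an ascent or a descent. A descent displaces
  the guest at its start in the left case; an ascent displaces the guest at its end in the right
  case. Hence the two numbers of displaced guests add up to \<open>n\<close>.
\<close>

lemma cycle_weight_eq_power:
  assumes n: "2 \<le> n" and xs: "xs \<in> permutations_of_set {..<n}"
  shows "cycle_weight a b xs = a ^ (n - card (displaced True xs)) * b ^ card (displaced True xs)"
    and "card (displaced True xs) + card (displaced False xs) = n"
proof -
  have len: "length xs = n" and dist: "distinct xs"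
    using length_finite_permutations_of_set[OF xs] xs by (auto dest: permutations_of_setD)
  have D: "displaced True xs = {i\<in>{..<n}. \<not> xs ! i < xs ! (Suc i mod n)}" (is "_ = ?D")
  proof -
    have "xs ! (Suc i mod n) < xs ! i \<longleftrightarrow> \<not> xs ! i < xs ! (Suc i mod n)" if "i < n" for i
    proof -
      have "xs ! (Suc i mod n) \<noteq> xs ! i"
        using that dist len neighbour_neq[OF n that, of True]
        by (simp add: nth_eq_iff_index_eq neighbour_def)
      then show ?thesis by linarith
    qed
    then show ?thesis unfolding displaced_def len neighbour_def by auto
  qed
  have "cycle_weight a b xs = (\<Prod>i<n. if i \<in> ?D then b else a)"
    unfolding cycle_weight_def len by (rule prod.cong) (auto simp: step_weight_def)
  also have "\<dots> = b ^ card ?D * a ^ card ({..<n} - ?D)"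
    by (subst prod.If_cases) (simp_all add: Int_absorb1 Diff_eq subset_iff)
  also have "card ({..<n} - ?D) = n - card ?D"
    by (subst card_Diff_subset) auto
  finally show "cycle_weight a b xs = a ^ (n - card (displaced True xs)) * b ^ card (displaced True xs)"
    unfolding D by (simp only: mult.commute)
  have "displaced False xs = (\<lambda>i. Suc i mod n) ` ({..<n} - ?D)"
  proof (intro equalityI subsetI)
    fix i assume "i \<in> displaced False xs"
    then have i: "i < n" "xs ! neighbour n False i < xs ! i" by (auto simp: displaced_def len)
    have "Suc (neighbour n False i) mod n = i"
      using side_napkin_neighbour[OF i(1), of False]
      by (simp add: side_napkin_def left_napkin_def right_napkin_def)
    then show "i \<in> (\<lambda>i. Suc i mod n) ` ({..<n} - ?D)"
      using i neighbour_less[OF i(1), of False] by (intro image_eqI[of _ _ "neighbour n False i"]) auto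
  next
    fix j assume "j \<in> (\<lambda>i. Suc i mod n) ` ({..<n} - ?D)"
    then obtain i where i: "i < n" "j = Suc i mod n" "xs ! i < xs ! j" by auto
    have "neighbour n False j = i"
    proof (cases "Suc i = n")
      case False
      then have "j + n - 1 = i + n" "j = Suc i" using i by auto
      then show ?thesis using i(1) by (simp add: neighbour_def)
    qed (use i n in \<open>auto simp: neighbour_def\<close>)
    then show "j \<in> displaced False xs" using i n by (simp add: displaced_def len)
  qed
  then have "card (displaced False xs) = card ({..<n} - ?D)"
    using n inj_on_subset[OF bij_betw_imp_inj_on[OF bij_betw_Suc_mod]]
    by (simp add: card_image)
  also have "\<dots> = n - card ?D" by (subst card_Diff_subset) auto
  finally show "card (displaced True xs) + card (displaced False xs) = n"
    unfolding D using card_mono[of "{..<n}" ?D] by (simp add: subset_iff)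
qed

text \<open>
  Of \<open>n\<close> guests, the \<open>n - d\<close> that are not displaced contribute \<open>p\<close>, the others \<open>p + q y\<close>.
\<close>

lemma Abs_fps_binomial:
  fixes p q :: real
  assumes "d \<le> n"
  shows "Abs_fps (\<lambda>j. real (d choose j) * p ^ (n - j) * q ^ j)
    = fps_const p ^ (n - d) * (fps_const p + fps_const q * fps_X) ^ d"
proof -
  have pow: "(fps_const p + fps_const q * fps_X) ^ d
      = (\<Sum>k\<le>d. fps_const (real (d choose k) * q ^ k * p ^ (d - k)) * fps_X ^ k)"
    by (subst add.commute, subst binomial_ring)
       (simp add: power_mult_distrib fps_const_power fps_of_nat[symmetric] fps_const_mult[symmetric]
          mult_ac del: fps_const_mult)
  have "(fps_const p ^ (n - d) * (fps_const p + fps_const q * fps_X) ^ d) $ j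
      = real (d choose j) * p ^ (n - j) * q ^ j" for j
  proof (cases "j \<le> d")
    case True
    then have "p ^ (n - d) * p ^ (d - j) = p ^ (n - j)"
      using assms by (simp add: power_add[symmetric])
    moreover have "(fps_const p ^ (n - d) * (fps_const p + fps_const q * fps_X) ^ d) $ j
        = real (d choose j) * (p ^ (n - d) * p ^ (d - j)) * q ^ j"
      unfolding pow using True by (simp add: fps_sum_nth if_distrib cong: if_cong)
    ultimately show ?thesis by simp
  qed (unfold pow, simp add: fps_sum_nth)
  then show ?thesis by (intro fps_ext) simp
qed

text \<open>
  In the right case the ascents are the free steps, so \<open>p y + q\<close> is the weight of an ascent there.
\<close>

lemma pr0_gf:
  assumes p: "0 < p" "p < 1" and q: "q = 1 - p" and n: "2 \<le> n"
  defines "Pc \<equiv> fls_const p" and "Qc \<equiv> fls_const q"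
  shows "fps_to_fls (Abs_fps (\<lambda>j. pr0 p j n)) = (\<Sum>xs\<in>permutations_of_set {..<n}.
      cycle_weight Pc (Pc + Qc * gf_y) xs + cycle_weight (Pc * gf_y + Qc) Qc xs) / fact n"
proof -
  let ?X = "permutations_of_set {..<n}"
  let ?d = "\<lambda>s xs. card (displaced s xs)"
  let ?f = "\<lambda>p q d. fps_const p ^ (n - d) * (fps_const p + fps_const q * fps_X) ^ d :: real fps"
  have le: "?d s xs \<le> n" if "xs \<in> ?X" for s xs
    using cycle_weight_eq_power(2)[OF n that] by (cases s) auto
  have "Abs_fps (\<lambda>j. pr0 p j n) = fps_const (1 / fact n) *
      (\<Sum>xs\<in>?X. Abs_fps (\<lambda>j. real (?d True xs choose j) * p ^ (n - j) * q ^ j)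
        + Abs_fps (\<lambda>j. real (?d False xs choose j) * q ^ (n - j) * p ^ j))"
    using p q by (intro fps_ext) (simp add: pr0_eq[OF n] fps_sum_nth)
  also have "\<dots> = fps_const (1 / fact n) * (\<Sum>xs\<in>?X. ?f p q (?d True xs) + ?f q p (?d False xs))"
    by (intro arg_cong2[of _ _ _ _ "(*)"] sum.cong refl) (simp only: Abs_fps_binomial[OF le])
  finally have eq: "Abs_fps (\<lambda>j. pr0 p j n)
      = fps_const (1 / fact n) * (\<Sum>xs\<in>?X. ?f p q (?d True xs) + ?f q p (?d False xs))" .
  have sum: "fps_to_fls (\<Sum>x\<in>S. g x) = (\<Sum>x\<in>S. fps_to_fls (g x))" for S :: "nat list set" and g :: "_ \<Rightarrow> real fps"
    by (induction S rule: infinite_finite_induct) auto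
  have "fps_to_fls (Abs_fps (\<lambda>j. pr0 p j n)) = fls_const (1 / fact n) *
      (\<Sum>xs\<in>?X. Pc ^ (n - ?d True xs) * (Pc + Qc * gf_y) ^ ?d True xs
        + Qc ^ (n - ?d False xs) * (Qc + Pc * gf_y) ^ ?d False xs)"
    unfolding eq Pc_def Qc_def 
    by (simp add: fls_times_fps_to_fls fps_to_fls_power sum gf_y_def del: fps_const_power)
  also have "\<dots> = fls_const (1 / fact n) * (\<Sum>xs\<in>?X.
      cycle_weight Pc (Pc + Qc * gf_y) xs + cycle_weight (Pc * gf_y + Qc) Qc xs)"
  proof (intro arg_cong2[of _ _ _ _ "(*)"] sum.cong refl)
    fix xs assume xs: "xs \<in> ?X"
    have "n - ?d False xs = ?d True xs" "?d False xs = n - ?d True xs"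
      using cycle_weight_eq_power(2)[OF n xs] by auto
    then show "Pc ^ (n - ?d True xs) * (Pc + Qc * gf_y) ^ ?d True xs
        + Qc ^ (n - ?d False xs) * (Qc + Pc * gf_y) ^ ?d False xs
      = cycle_weight Pc (Pc + Qc * gf_y) xs + cycle_weight (Pc * gf_y + Qc) Qc xs"
      by (simp only: cycle_weight_eq_power(1)[OF n xs] add.commute mult.commute)
  qed
  also have "fls_const (1 / fact n) = 1 / (fact n :: real fls)"
  proof -
    have "fls_const (fact n :: real) = fact n"
      by (metis fls_of_nat of_nat_fact)
    then have "fls_const (1 / fact n) * (fact n :: real fls) = 1"
      by (metis fls_const_mult_const fls_const_1 fact_nonzero nonzero_eq_divide_eq)
    then show ?thesis by (simp add: nonzero_eq_divide_eq)
  qed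
  finally show ?thesis by simp
qed

text \<open>
  With a single napkin the right and the left napkin coincide, so the guest gets what he prefers.
\<close>

lemma pr0_one: "pr0 p j 1 = (if j = 0 then 1 else 0)"
proof -
  have served: "napkin_of 1 [0] pref 0 = Some 0" and pref: "preferred_napkin 1 pref 0 = 0" for pref
    by (simp_all add: napkin_of_def take_napkin_def preferred_napkin_def left_napkin_def right_napkin_def)
  then have "\<not> frustrated 1 [0] pref 0" for pref
    by (simp add: frustrated_def del: One_nat_def)
  then have none: "{i. i < 1 \<and> frustrated 1 [0] pref i} = {}" for pref
    using less_one by blast
  have "{pref. ([0], pref) \<in> {(ord, pref). (\<forall>i<1. napkin_of 1 ord pref i \<noteq> None) \<and>
      card {i. i < 1 \<and> frustrated 1 ord pref i} = j}} = (if j = 0 then UNIV else {})"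
    using served unfolding prod.case mem_Collect_eq none by auto
  moreover have "permutations_of_set {..<1::nat} = {[0]}"
    by (simp add: lessThan_Suc)
  ultimately show ?thesis
    unfolding pr0_def table_pmf_def by (simp add: prob_pair_pmf_of_set del: One_nat_def)
qed

theorem mainTheorem4:
  fixes p q :: real
  assumes "0 < p" and "p < 1" and "q = 1 - p"
  defines "P \<equiv> fps_const (fls_const p)"
      and "Q \<equiv> fps_const (fls_const q)"
      and "Y \<equiv> fps_const gf_y"
      and "Eq \<equiv> fps_exp (fls_const q * gf_y)"
      and "Ep \<equiv> fps_exp (fls_const p * gf_y)"
  shows "gf_C0 p =
    fps_X * (1 + (P + Q * Y) * P * (Eq - 1) / (Q * Y - P * (Eq - 1))
               + (P * Y + Q) * Q * (Ep - 1) / (P * Y - Q * (Ep - 1)))"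
proof -
  define a b where "a = fls_const p" and "b = fls_const q"
  have nz: "a * gf_y \<noteq> 0" "b * gf_y \<noteq> 0"
    using assms(1-3) by (auto simp: a_def b_def gf_y_def)
  have egf: "eulerian_egf u (u + v * gf_y) = (fps_exp (v * gf_y) - 1) /
      (fps_const (v * gf_y) - fps_const u * (fps_exp (v * gf_y) - 1))" if "v * gf_y \<noteq> 0" for u v
    using eulerian_egf_eq[of u "u + v * gf_y"] that by simp
  \<comment> \<open>The denominators have the non-zero constant terms \<open>q y\<close> and \<open>p y\<close>, hence are units, and
    division by them is associative with multiplication.\<close>
  have left: "(P + Q * Y) * P * (Eq - 1) / (Q * Y - P * (Eq - 1))
      = fps_const (a * (a + b * gf_y)) * eulerian_egf a (a + b * gf_y)"
  proof -
    let ?D = "Q * Y - P * (Eq - 1)"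
    have "?D $ 0 \<noteq> 0" using nz by (simp add: P_def Q_def Y_def Eq_def a_def b_def)
    then have split: "(P + Q * Y) * P * (Eq - 1) / ?D = (P + Q * Y) * P * ((Eq - 1) / ?D)"
      by (simp add: fps_divide_unit mult.assoc)
    have egf_part: "(Eq - 1) / ?D = eulerian_egf a (a + b * gf_y)"
      unfolding egf[OF nz(2)] by (simp add: P_def Q_def Y_def Eq_def a_def b_def)
    have factor: "(P + Q * Y) * P = fps_const (a * (a + b * gf_y))"
      by (simp add: P_def Q_def Y_def a_def b_def mult.commute)
    show ?thesis by (rule trans[OF split arg_cong2[of _ _ _ _ "(*)", OF factor egf_part]])
  qed
  have right: "(P * Y + Q) * Q * (Ep - 1) / (P * Y - Q * (Ep - 1))
      = fps_const ((a * gf_y + b) * b) * eulerian_egf b (b + a * gf_y)"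
  proof -
    let ?D = "P * Y - Q * (Ep - 1)"
    have "?D $ 0 \<noteq> 0" using nz by (simp add: P_def Q_def Y_def Ep_def a_def b_def)
    then have split: "(P * Y + Q) * Q * (Ep - 1) / ?D = (P * Y + Q) * Q * ((Ep - 1) / ?D)"
      by (simp add: fps_divide_unit mult.assoc)
    have egf_part: "(Ep - 1) / ?D = eulerian_egf b (b + a * gf_y)"
      unfolding egf[OF nz(1)] by (simp add: P_def Q_def Y_def Ep_def a_def b_def)
    have factor: "(P * Y + Q) * Q = fps_const ((a * gf_y + b) * b)"
      by (simp add: P_def Q_def Y_def a_def b_def)
    show ?thesis by (rule trans[OF split arg_cong2[of _ _ _ _ "(*)", OF factor egf_part]])
  qed
  have "gf_C0 p = fps_X * (1 + fps_const (a * (a + b * gf_y)) * eulerian_egf a (a + b * gf_y)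
      + fps_const ((a * gf_y + b) * b) * eulerian_egf b (b + a * gf_y))" (is "_ = fps_X * ?R")
  proof (rule fps_ext)
    fix n
    consider "n = 0" | "n = 1" | m where "n = Suc m" "0 < m"
      by (metis One_nat_def not0_implies_Suc not_gr_zero)
    then show "gf_C0 p $ n = (fps_X * ?R) $ n"
    proof cases
      case 2
      have "Abs_fps (\<lambda>j. pr0 p j 1) = 1"
        by (rule fps_ext) (simp add: pr0_one del: One_nat_def)
      then show ?thesis using 2 by (simp add: gf_C0_def eulerian_egf_def)
    next
      case (3 m)
      let ?X = "permutations_of_set {..<Suc m}"
      have "gf_C0 p $ n = (\<Sum>xs\<in>?X. cycle_weight a (a + b * gf_y) xs
          + cycle_weight (a * gf_y + b) b xs) / fact (Suc m)"
        using 3 pr0_gf[OF assms(1-3), of "Suc m"] by (simp add: gf_C0_def a_def b_def)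
      also have "\<dots> = of_nat (Suc m) * (a * (a + b * gf_y) * eulerian a (a + b * gf_y) m
          + (a * gf_y + b) * b * eulerian (a * gf_y + b) b m) / fact (Suc m)"
        unfolding sum.distrib sum_cycle_weight[OF 3(2)] by (simp only: distrib_left)
      also have "\<dots> = (a * (a + b * gf_y) * eulerian a (a + b * gf_y) m
          + (a * gf_y + b) * b * eulerian b (b + a * gf_y) m) / fact m"
      proof -
        have "eulerian (a * gf_y + b) b m = eulerian b (b + a * gf_y) m"
          unfolding eulerian_commute[of "a * gf_y + b" b] by (simp only: add.commute)
        moreover have "of_nat (Suc m) \<noteq> (0 :: real fls)" by (rule of_nat_neq_0)
        ultimately show ?thesis
          by (simp only: fact_Suc mult_divide_mult_cancel_left_if if_False)
      qed
      also have "\<dots> = (fps_X * ?R) $ n"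
        using 3 by (simp add: eulerian_egf_def add_divide_distrib)
      finally show ?thesis .
    qed (simp add: gf_C0_def)
  qed
  then show ?thesis unfolding left right .
qed

end
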